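(* Let $\lambda\neq0$ be a real number and let $X=f_1e_1+f_2e_2+f_3e_3$ be an arbitrary vector field on $(H_3,g_2)$, where $f_1,f_2,f_3$ are smooth real functions of $(x,y,z)\in\mathbb{R}^3$. Then $X$ is a Ricci collineation if and only if there exist real constants $c_1,c_2,c_3,c_4$ such that $$\begin{cases} f_1(x,y,z)=-\frac{c_1}{\lambda}x+c_2,\\ f_2(x,y,z)=c_1y+c_3,\\ f_3(x,y,z)=-\frac{c_1}{2\lambda}x^2-\frac{\lambda c_1}{2}y^2+c_2x-\lambda c_3y+c_4.\end{cases}$$
   Context: The Heisenberg group $H_3$ is $\mathbb{R}^3$ with global coordinates $(x,y,z)$ and multiplication $(x,y,z)(\tilde x,\tilde y,\tilde z)=(x+\tilde x,y+\tilde y,z+\tilde z-x\tilde y)$. For $\lambda\neq0$, $g_2$ is the left-invariant Lorentzian metric $g_2=\frac{1}{\lambda^2}dx^2+dy^2-(x\,dy+dz)^2$, with left-invariant orthonormal frame $e_1=\partial_y-x\partial_z$, $e_2=\lambda\partial_x$, $e_3=\partial_z$ ($e_3$ timelike). With $R(X,Y)=[\nabla_X,\nabla_Y]-\nabla_{[X,Y]}$ the curvature tensor of the Levi-Civita connection, the Ricci tensor is $\varrho(X,Y)=\sum_k g(e_k,e_k)\,g(R(e_k,X)Y,e_k)$ for an orthonormal basis $\{e_k\}$. A smooth vector field $X$ is a Ricci collineation if $\mathcal{L}_X\varrho=0$. *)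

theory Defs
  imports "HOL-Analysis.Analysis"
begin

primrec times_differentiable ::
    "nat \<Rightarrow> ('a::real_normed_vector \<Rightarrow> 'b::real_normed_vector) \<Rightarrow> bool" where
  "times_differentiable 0 f \<longleftrightarrow> continuous_on UNIV f"
| "times_differentiable (Suc n) f \<longleftrightarrow>
     (\<forall>p. f differentiable (at p)) \<and>
     (\<forall>v. times_differentiable n (\<lambda>p. frechet_derivative f (at p) v))"

definition smooth :: "('a::real_normed_vector \<Rightarrow> 'b::real_normed_vector) \<Rightarrow> bool" where
  "smooth f \<longleftrightarrow> (\<forall>n. times_differentiable n f)"

text \<open>A vector field is given by its components in the standard global coordinates, so that
  a vector field on \<open>'a\<close> is a function \<open>'a \<Rightarrow> 'a\<close>. A metric is given by its
  value \<open>g p u v\<close> at the point \<open>p\<close> on the tangent vectors \<open>u\<close> and \<open>v\<close>.\<close>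

definition dir_deriv ::
    "('a::real_normed_vector \<Rightarrow> 'a) \<Rightarrow> ('a \<Rightarrow> 'b::real_normed_vector) \<Rightarrow> 'a \<Rightarrow> 'b" where
  "dir_deriv X f p = frechet_derivative f (at p) (X p)"

definition lie_bracket ::
    "('a::real_normed_vector \<Rightarrow> 'a) \<Rightarrow> ('a \<Rightarrow> 'a) \<Rightarrow> 'a \<Rightarrow> 'a" where
  "lie_bracket X Y p = dir_deriv X Y p - dir_deriv Y X p"

definition affine_connection ::
    "(('a::real_normed_vector \<Rightarrow> 'a) \<Rightarrow> ('a \<Rightarrow> 'a) \<Rightarrow> 'a \<Rightarrow> 'a) \<Rightarrow> bool" where
  "affine_connection D \<longleftrightarrow>
     (\<forall>X Y. smooth X \<longrightarrow> smooth Y \<longrightarrow> smooth (D X Y)) \<and>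
     (\<forall>X X' Y. smooth X \<longrightarrow> smooth X' \<longrightarrow> smooth Y \<longrightarrow>
        (\<forall>p. D (\<lambda>q. X q + X' q) Y p = D X Y p + D X' Y p)) \<and>
     (\<forall>f X Y. smooth (f :: 'a \<Rightarrow> real) \<longrightarrow> smooth X \<longrightarrow> smooth Y \<longrightarrow>
        (\<forall>p. D (\<lambda>q. f q *\<^sub>R X q) Y p = f p *\<^sub>R D X Y p)) \<and>
     (\<forall>X Y Y'. smooth X \<longrightarrow> smooth Y \<longrightarrow> smooth Y' \<longrightarrow>
        (\<forall>p. D X (\<lambda>q. Y q + Y' q) p = D X Y p + D X Y' p)) \<and>
     (\<forall>f X Y. smooth (f :: 'a \<Rightarrow> real) \<longrightarrow> smooth X \<longrightarrow> smooth Y \<longrightarrow>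
        (\<forall>p. D X (\<lambda>q. f q *\<^sub>R Y q) p = dir_deriv X f p *\<^sub>R Y p + f p *\<^sub>R D X Y p))"

definition torsion_free ::
    "(('a::real_normed_vector \<Rightarrow> 'a) \<Rightarrow> ('a \<Rightarrow> 'a) \<Rightarrow> 'a \<Rightarrow> 'a) \<Rightarrow> bool" where
  "torsion_free D \<longleftrightarrow>
     (\<forall>X Y. smooth X \<longrightarrow> smooth Y \<longrightarrow> (\<forall>p. D X Y p - D Y X p = lie_bracket X Y p))"

definition metric_compatible ::
    "('a::real_normed_vector \<Rightarrow> 'a \<Rightarrow> 'a \<Rightarrow> real) \<Rightarrow>
     (('a \<Rightarrow> 'a) \<Rightarrow> ('a \<Rightarrow> 'a) \<Rightarrow> 'a \<Rightarrow> 'a) \<Rightarrow> bool" where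
  "metric_compatible g D \<longleftrightarrow>
     (\<forall>X Y Z. smooth X \<longrightarrow> smooth Y \<longrightarrow> smooth Z \<longrightarrow>
        (\<forall>p. dir_deriv X (\<lambda>q. g q (Y q) (Z q)) p =
              g p (D X Y p) (Z p) + g p (Y p) (D X Z p)))"

text \<open>For a smooth nondegenerate \<open>g\<close> these conditions determine \<open>D X Y\<close> for smooth \<open>X\<close>
  and \<open>Y\<close>. They say nothing about non-smooth arguments, hence \<open>SOME\<close> rather than \<open>THE\<close>;
  the connection is only ever applied to smooth fields below.\<close>

definition levi_civita ::
    "('a::real_normed_vector \<Rightarrow> 'a \<Rightarrow> 'a \<Rightarrow> real) \<Rightarrow>
     ('a \<Rightarrow> 'a) \<Rightarrow> ('a \<Rightarrow> 'a) \<Rightarrow> 'a \<Rightarrow> 'a" where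
  "levi_civita g = (SOME D. affine_connection D \<and> torsion_free D \<and> metric_compatible g D)"

definition curvature ::
    "(('a::real_normed_vector \<Rightarrow> 'a) \<Rightarrow> ('a \<Rightarrow> 'a) \<Rightarrow> 'a \<Rightarrow> 'a) \<Rightarrow>
     ('a \<Rightarrow> 'a) \<Rightarrow> ('a \<Rightarrow> 'a) \<Rightarrow> ('a \<Rightarrow> 'a) \<Rightarrow> 'a \<Rightarrow> 'a" where
  "curvature D X Y Z p = D X (D Y Z) p - D Y (D X Z) p - D (lie_bracket X Y) Z p"

text \<open>The frame \<open>e\<close> is meant to be orthonormal for \<open>g\<close>; the result does not depend on
  which orthonormal frame is used.\<close>

definition ricci ::
    "('a::real_normed_vector \<Rightarrow> 'a \<Rightarrow> 'a \<Rightarrow> real) \<Rightarrow> ('n::finite \<Rightarrow> 'a \<Rightarrow> 'a) \<Rightarrow>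
     ('a \<Rightarrow> 'a) \<Rightarrow> ('a \<Rightarrow> 'a) \<Rightarrow> 'a \<Rightarrow> real" where
  "ricci g e X Y p =
     (\<Sum>k\<in>UNIV. g p (e k p) (e k p) * g p (curvature (levi_civita g) (e k) X Y p) (e k p))"

definition lie_deriv2 ::
    "('a::real_normed_vector \<Rightarrow> 'a) \<Rightarrow> (('a \<Rightarrow> 'a) \<Rightarrow> ('a \<Rightarrow> 'a) \<Rightarrow> 'a \<Rightarrow> real) \<Rightarrow>
     ('a \<Rightarrow> 'a) \<Rightarrow> ('a \<Rightarrow> 'a) \<Rightarrow> 'a \<Rightarrow> real" where
  "lie_deriv2 X T Y Z p =
     dir_deriv X (T Y Z) p - T (lie_bracket X Y) Z p - T Y (lie_bracket X Z) p"

definition ricci_collineation ::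
    "('a::real_normed_vector \<Rightarrow> 'a \<Rightarrow> 'a \<Rightarrow> real) \<Rightarrow> ('n::finite \<Rightarrow> 'a \<Rightarrow> 'a) \<Rightarrow>
     ('a \<Rightarrow> 'a) \<Rightarrow> bool" where
  "ricci_collineation g e X \<longleftrightarrow>
     smooth X \<and> (\<forall>Y Z. smooth Y \<longrightarrow> smooth Z \<longrightarrow> (\<forall>p. lie_deriv2 X (ricci g e) Y Z p = 0))"

definition heis_mult :: "real^3 \<Rightarrow> real^3 \<Rightarrow> real^3" where
  "heis_mult p q = vector [p$1 + q$1, p$2 + q$2, p$3 + q$3 - p$1 * q$2]"

definition heis_g2 :: "real \<Rightarrow> real^3 \<Rightarrow> real^3 \<Rightarrow> real^3 \<Rightarrow> real" where
  "heis_g2 l p u v =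
     u$1 * v$1 / l^2 + u$2 * v$2 - (p$1 * u$2 + u$3) * (p$1 * v$2 + v$3)"

definition heis_frame :: "real \<Rightarrow> 3 \<Rightarrow> real^3 \<Rightarrow> real^3" where
  "heis_frame l k p =
     (vector [vector [0, 1, - p$1], vector [l, 0, 0], vector [0, 0, 1]] :: real^3^3) $ k"

lemma heis_frame_orthonormal:
  assumes "l \<noteq> 0"
  shows "heis_g2 l p (heis_frame l j p) (heis_frame l k p) =
    (if j = k then if k = 3 then - 1 else 1 else 0)"
  using assms exhaust_3[of j] exhaust_3[of k]
  by (auto simp: heis_g2_def heis_frame_def power2_eq_square)

lemma heis_mult_has_derivative:
  "(heis_mult a has_derivative (\<lambda>v. vector [v$1, v$2, v$3 - a$1 * v$2])) (at p)"
proof -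
  have eq: "vector [u, v, w] = u *\<^sub>R axis 1 1 + v *\<^sub>R axis 2 1 + w *\<^sub>R (axis 3 1 :: real^3)"
    for u v w :: real
    by (simp add: vec_eq_iff forall_3 axis_def)
  show ?thesis
    unfolding heis_mult_def[abs_def] eq
    by (auto intro!: derivative_eq_intros bounded_linear.has_derivative[OF bounded_linear_vec_nth])
qed

lemma heis_frame_left_invariant:
  "frechet_derivative (heis_mult a) (at p) (heis_frame l k p) = heis_frame l k (heis_mult a p)"
  unfolding frechet_derivative_at[OF heis_mult_has_derivative, symmetric]
  using exhaust_3[of k]
  by (auto simp: heis_frame_def heis_mult_def vec_eq_iff forall_3)

lemma heis_g2_left_invariant:
  "heis_g2 l (heis_mult a p) (frechet_derivative (heis_mult a) (at p) u)
     (frechet_derivative (heis_mult a) (at p) v) = heis_g2 l p u v"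
  unfolding frechet_derivative_at[OF heis_mult_has_derivative, symmetric]
  by (simp add: heis_g2_def heis_mult_def algebra_simps)

end

theory Submission
  imports Defs
begin

text \<open>In the frame \<open>e\<^sub>1, e\<^sub>2, e\<^sub>3\<close> the Ricci tensor of \<open>g\<^sub>2\<close> is \<open>\<lambda>\<^sup>2/2\<close> times the identity
  matrix, so Ricci collineations are the Killing fields of a Riemannian left-invariant metric. With
  \<open>[e\<^sub>1, e\<^sub>2] = \<lambda> e\<^sub>3\<close> and \<open>e\<^sub>3\<close> central, the six Killing equations and the commutation
  relations force \<open>e\<^sub>3 f\<^sub>1 = e\<^sub>3 f\<^sub>2 = 0\<close>, after which \<open>e\<^sub>1 f\<^sub>2 = - e\<^sub>2 f\<^sub>1\<close> has all its
  derivatives zero; its constant value is \<open>c\<^sub>1\<close>, and \<open>c\<^sub>2, c\<^sub>3, c\<^sub>4\<close> are constants of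
  integration.\<close>

section \<open>Smooth functions and symmetry of second derivatives\<close>

text \<open>The mean value theorem is used twice: along \<open>u\<close> for the difference of
  \<open>f\<close> on two parallel lines that are \<open>h *\<^sub>R v\<close> apart, then along
  \<open>v\<close> for the derivative of \<open>f\<close> in direction \<open>u\<close>. The left
  side of the equation is symmetric in \<open>u\<close> and \<open>v\<close>, and symmetry of second
  derivatives rests on this.\<close>

lemma second_difference_mvt:
  fixes f :: "'a::real_normed_vector \<Rightarrow> real"
  assumes f: "\<And>p. f differentiable (at p)"
    and f': "\<And>p. (\<lambda>q. frechet_derivative f (at q) u) differentiable (at p)"
    and h: "h > 0"
  obtains s t where "0 < s" "s < h" "0 < t" "t < h"
    "f (p + h *\<^sub>R u + h *\<^sub>R v) - f (p + h *\<^sub>R u) - f (p + h *\<^sub>R v) + f p =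
      h^2 * frechet_derivative (\<lambda>q. frechet_derivative f (at q) u) (at (p + s *\<^sub>R u + t *\<^sub>R v)) v"
proof -
  \<comment> \<open>Restricting to a line reduces to one real variable, where the mean value theorem
    is available.\<close>
  have line: "((\<lambda>s. F (a + s *\<^sub>R w)) has_real_derivative
      frechet_derivative F (at (a + s *\<^sub>R w)) w) (at s)"
    if F: "\<And>p. F differentiable (at p)" for F :: "'a \<Rightarrow> real" and a w s
  proof -
    have F': "(F has_derivative frechet_derivative F (at (a + s *\<^sub>R w))) (at (a + s *\<^sub>R w))"
      using F frechet_derivative_works by blast
    have "((\<lambda>s. a + s *\<^sub>R w) has_derivative (\<lambda>t. t *\<^sub>R w)) (at s)"
      by (auto intro!: derivative_eq_intros)
    from has_derivative_compose[OF this F'] show ?thesis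
      using linear_frechet_derivative[OF F, of "a + s *\<^sub>R w"]
      by (simp add: has_field_derivative_def linear_cmul mult_commute_abs)
  qed
  define \<phi> where "\<phi> = (\<lambda>s. f (p + h *\<^sub>R v + s *\<^sub>R u) - f (p + s *\<^sub>R u))"
  have "(\<phi> has_real_derivative frechet_derivative f (at (p + h *\<^sub>R v + s *\<^sub>R u)) u
      - frechet_derivative f (at (p + s *\<^sub>R u)) u) (at s)" for s
    unfolding \<phi>_def by (intro DERIV_diff line f)
  from MVT2[OF h this] obtain s where s: "0 < s" "s < h"
    and \<phi>: "\<phi> h - \<phi> 0 = h * (frechet_derivative f (at (p + h *\<^sub>R v + s *\<^sub>R u)) u
      - frechet_derivative f (at (p + s *\<^sub>R u)) u)"
    by auto
  obtain t where t: "0 < t" "t < h"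
    and \<psi>: "frechet_derivative f (at (p + s *\<^sub>R u + h *\<^sub>R v)) u
      - frechet_derivative f (at (p + s *\<^sub>R u + 0 *\<^sub>R v)) u =
      h * frechet_derivative (\<lambda>q. frechet_derivative f (at q) u) (at (p + s *\<^sub>R u + t *\<^sub>R v)) v"
    using MVT2[OF h line[OF f', of "p + s *\<^sub>R u" v]] by auto
  show thesis
    using that[OF s t] \<phi> \<psi>
    by (simp add: \<phi>_def power2_eq_square algebra_simps)
qed

text \<open>The second difference divided by \<open>h^2\<close> is symmetric in the two directions.
  By its mean value form and continuity of the second derivatives it tends to both mixed derivatives
  as \<open>h\<close> decreases to 0, so these agree.\<close>

lemma symmetric_second_derivative_real:
  fixes f :: "'a::real_normed_vector \<Rightarrow> real"
  assumes f: "\<And>p. f differentiable (at p)"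
    and f': "\<And>w p. (\<lambda>q. frechet_derivative f (at q) w) differentiable (at p)"
    and f'': "\<And>w w'. continuous_on UNIV
      (\<lambda>p. frechet_derivative (\<lambda>q. frechet_derivative f (at q) w) (at p) w')"
  shows "frechet_derivative (\<lambda>q. frechet_derivative f (at q) u) (at p) v =
    frechet_derivative (\<lambda>q. frechet_derivative f (at q) v) (at p) u"
proof -
  define H where "H w w' q = frechet_derivative (\<lambda>q. frechet_derivative f (at q) w) (at q) w'" for w w' q
  define Q where "Q h = (f (p + h *\<^sub>R u + h *\<^sub>R v) - f (p + h *\<^sub>R u) - f (p + h *\<^sub>R v) + f p) / h^2"
    for h :: real
  have lim: "((\<lambda>h. (f (p + h *\<^sub>R w + h *\<^sub>R w') - f (p + h *\<^sub>R w) - f (p + h *\<^sub>R w') + f p) / h^2) \<longlongrightarrow> H w w' p)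
      (at_right 0)" for w w'
  proof -
    \<comment> \<open>The condition \<open>0 < h\<close> stands inside the existential, so that the
      intermediate points can be chosen as functions of every real \<open>h\<close>.\<close>
    have "\<exists>s t. 0 < h \<longrightarrow> 0 < s \<and> s < h \<and> 0 < t \<and> t < h \<and>
      (f (p + h *\<^sub>R w + h *\<^sub>R w') - f (p + h *\<^sub>R w) - f (p + h *\<^sub>R w') + f p) / h^2
        = H w w' (p + s *\<^sub>R w + t *\<^sub>R w')" for h
      using second_difference_mvt[OF f f', of h p w w'] unfolding H_def
      by (metis nonzero_mult_div_cancel_left less_irrefl power_not_zero)
    then obtain s t where st: "\<And>h. 0 < h \<Longrightarrow> 0 < s h \<and> s h < h \<and> 0 < t h \<and> t h < h \<and>
      (f (p + h *\<^sub>R w + h *\<^sub>R w') - f (p + h *\<^sub>R w) - f (p + h *\<^sub>R w') + f p) / h^2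
        = H w w' (p + s h *\<^sub>R w + t h *\<^sub>R w')"
      by metis
    have ev: "\<forall>\<^sub>F h :: real in at_right 0. 0 < h"
      by (simp add: eventually_at_right_less)
    have small: "(r \<longlongrightarrow> 0) (at_right 0)" if "\<And>h. 0 < h \<Longrightarrow> 0 < r h \<and> r h < h" for r :: "real \<Rightarrow> real"
      by (rule tendsto_sandwich[of "\<lambda>_. 0" _ _ "\<lambda>h. h"])
        (use that in \<open>auto intro!: eventually_mono[OF ev] tendsto_eq_intros less_imp_le\<close>)
    have "((\<lambda>h. p + s h *\<^sub>R w + t h *\<^sub>R w') \<longlongrightarrow> p + 0 *\<^sub>R w + 0 *\<^sub>R w') (at_right 0)"
      by (intro tendsto_intros small) (use st in auto)
    then have "((\<lambda>h. H w w' (p + s h *\<^sub>R w + t h *\<^sub>R w')) \<longlongrightarrow> H w w' p) (at_right 0)"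
      using f''[of w w'] unfolding H_def[symmetric]
      by (auto intro!: isCont_tendsto_compose[where g = "H w w'"] simp: continuous_on_eq_continuous_at)
    then show ?thesis
      by (rule Lim_transform_eventually) (rule eventually_mono[OF ev], use st in simp)
  qed
  have "(Q \<longlongrightarrow> H u v p) (at_right 0)"
    unfolding Q_def by (rule lim)
  moreover have "(Q \<longlongrightarrow> H v u p) (at_right 0)"
    using lim[of v u] unfolding Q_def by (simp add: algebra_simps)
  ultimately show ?thesis
    unfolding H_def using tendsto_unique trivial_limit_at_right_real by blast
qed

section \<open>Closure properties of smooth functions\<close>

lemma times_differentiable_SucD: "times_differentiable (Suc n) f \<Longrightarrow> times_differentiable n f"
  by (induction n arbitrary: f)
    (auto simp: continuous_on_eq_continuous_at differentiable_imp_continuous_within)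

lemma smooth_differentiable: "smooth f \<Longrightarrow> f differentiable (at p)"
  unfolding smooth_def by (metis times_differentiable.simps(2))

lemma smooth_has_derivative:
  "smooth f \<Longrightarrow> (f has_derivative frechet_derivative f (at p)) (at p)"
  using smooth_differentiable frechet_derivative_works by blast

lemma smooth_frechet_derivative: "smooth f \<Longrightarrow> smooth (\<lambda>p. frechet_derivative f (at p) v)"
  unfolding smooth_def by (metis times_differentiable.simps(2))

lemma smooth_continuous: "smooth f \<Longrightarrow> continuous_on UNIV f"
  unfolding smooth_def by (metis times_differentiable.simps(1))

lemma times_differentiable_const: "times_differentiable n (\<lambda>_. c)"
  by (induction n arbitrary: c) auto

lemma smooth_const [simp, intro]: "smooth (\<lambda>_. c)"
  by (simp add: smooth_def times_differentiable_const)

text \<open>The derivative in a fixed direction is constant, so nothing remains to be checked beyond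
  the first order.\<close>

lemma smooth_bounded_linear:
  assumes "bounded_linear f"
  shows "smooth f"
  unfolding smooth_def
proof
  fix n
  have "(\<lambda>p. frechet_derivative f (at p) v) = (\<lambda>_. f v)" for v
    using frechet_derivative_at[OF bounded_linear_imp_has_derivative[OF assms]] by metis
  then show "times_differentiable n f"
    by (cases n) (auto simp: times_differentiable_const bounded_linear_imp_differentiable assms
        linear_continuous_on)
qed

lemma smooth_vec_nth [simp, intro]: "smooth (\<lambda>p::real^'n. p $ i)"
  by (rule smooth_bounded_linear) (rule bounded_linear_vec_nth)

lemma times_differentiable_add:
  "times_differentiable n f \<Longrightarrow> times_differentiable n g \<Longrightarrow> times_differentiable n (\<lambda>p. f p + g p)"
proof (induction n arbitrary: f g)
  case (Suc n)
  have "frechet_derivative (\<lambda>p. f p + g p) (at p) =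
      (\<lambda>v. frechet_derivative f (at p) v + frechet_derivative g (at p) v)" for p
    by (rule frechet_derivative_at[symmetric], intro has_derivative_add)
      (use Suc.prems in \<open>auto simp: frechet_derivative_works[symmetric]\<close>)
  with Suc show ?case by auto
qed (auto intro: continuous_on_add)

lemma smooth_add [intro]: "smooth f \<Longrightarrow> smooth g \<Longrightarrow> smooth (\<lambda>p. f p + g p)"
  by (simp add: smooth_def times_differentiable_add)

text \<open>By the product rule a derivative of \<open>B (f p) (g p)\<close> is a sum of two terms
  of the same shape, so induction on the order applies; the factor left undifferentiated is used at
  the lower order. Scalar multiples, products and inner products are all instances.\<close>

lemma times_differentiable_bilinear:
  assumes "bounded_bilinear B"
  shows "times_differentiable n f \<Longrightarrow> times_differentiable n g \<Longrightarrow>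
    times_differentiable n (\<lambda>p. B (f p) (g p))"
proof (induction n arbitrary: f g)
  case 0
  then show ?case
    using bounded_bilinear.continuous_on[OF assms] by auto
next
  case (Suc n)
  have deriv: "((\<lambda>p. B (f p) (g p)) has_derivative
      (\<lambda>v. B (f p) (frechet_derivative g (at p) v) + B (frechet_derivative f (at p) v) (g p))) (at p)" for p
    by (rule bounded_bilinear.FDERIV[OF assms])
      (use Suc.prems in \<open>auto simp: frechet_derivative_works[symmetric]\<close>)
  have "times_differentiable n
      (\<lambda>p. B (f p) (frechet_derivative g (at p) v) + B (frechet_derivative f (at p) v) (g p))" for v
    using Suc.prems by (intro times_differentiable_add Suc.IH) (auto intro: times_differentiable_SucD)
  then show ?case
    using deriv by (auto simp: frechet_derivative_at[OF deriv, symmetric] differentiable_def)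
qed

lemma smooth_scaleR [intro]: "smooth f \<Longrightarrow> smooth g \<Longrightarrow> smooth (\<lambda>p. f p *\<^sub>R g p)"
  by (simp add: smooth_def times_differentiable_bilinear bounded_bilinear_scaleR)

lemma smooth_mult [intro]:
  fixes f g :: "'a::real_normed_vector \<Rightarrow> 'b::real_normed_algebra"
  shows "smooth f \<Longrightarrow> smooth g \<Longrightarrow> smooth (\<lambda>p. f p * g p)"
  by (simp add: smooth_def times_differentiable_bilinear bounded_bilinear_mult)

lemma smooth_minus [intro]: "smooth f \<Longrightarrow> smooth (\<lambda>p. - f p)"
  using smooth_scaleR[OF smooth_const, of f "-1"] by simp

lemma smooth_diff [intro]: "smooth f \<Longrightarrow> smooth g \<Longrightarrow> smooth (\<lambda>p. f p - g p)"
  using smooth_add[OF _ smooth_minus, of f g] by simp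

lemma smooth_sum [intro]: "(\<And>i. i \<in> I \<Longrightarrow> smooth (f i)) \<Longrightarrow> smooth (\<lambda>p. \<Sum>i\<in>I. f i p)"
  by (induction I rule: infinite_finite_induct) auto

lemma smooth_inner_right [intro]:
  assumes "smooth f"
  shows "smooth (\<lambda>p. f p \<bullet> c)"
  using times_differentiable_bilinear[OF bounded_bilinear_inner _ times_differentiable_const] assms
  by (auto simp: smooth_def)

lemma smooth_component [intro]: "smooth f \<Longrightarrow> smooth (\<lambda>p. (f p :: real^'n) $ i)"
  using smooth_inner_right[of f "axis i 1"] by (simp add: inner_axis)

text \<open>Written with constant axis vectors, a coordinate triple falls under the rules for sums
  and scalar multiples.\<close>

lemma vector_3_axis:
  "vector [a, b, c] = a *\<^sub>R axis 1 1 + b *\<^sub>R axis 2 1 + c *\<^sub>R (axis 3 1 :: real^3)"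
  by (simp add: vec_eq_iff forall_3 axis_def)

lemma smooth_vector_3 [intro]:
  "smooth a \<Longrightarrow> smooth b \<Longrightarrow> smooth c \<Longrightarrow> smooth (\<lambda>p. vector [a p, b p, c p] :: real^3)"
  unfolding vector_3_axis by (intro smooth_add smooth_scaleR smooth_const)

section \<open>Derivatives along vector fields\<close>

lemma dir_deriv_eqI: "(f has_derivative f') (at p) \<Longrightarrow> dir_deriv X f p = f' (X p)"
  by (metis dir_deriv_def frechet_derivative_at)

text \<open>Smoothness speaks of derivatives in fixed directions only. This expansion reduces a
  direction that varies with the point to fixed ones with variable coefficients.\<close>

lemma frechet_derivative_Basis_sum:
  fixes f :: "'a::euclidean_space \<Rightarrow> 'b::real_normed_vector"
  assumes "f differentiable (at p)"
  shows "frechet_derivative f (at p) v = (\<Sum>b\<in>Basis. (v \<bullet> b) *\<^sub>R frechet_derivative f (at p) b)"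
  using linear_frechet_derivative[OF assms]
  by (subst euclidean_representation[of v, symmetric])
    (simp only: linear_sum linear_cmul)

lemma smooth_dir_deriv [intro]:
  fixes X :: "'a::euclidean_space \<Rightarrow> 'a"
  assumes "smooth X" "smooth f"
  shows "smooth (dir_deriv X f)"
proof -
  have "dir_deriv X f = (\<lambda>p. \<Sum>b\<in>Basis. (X p \<bullet> b) *\<^sub>R frechet_derivative f (at p) b)"
    using frechet_derivative_Basis_sum smooth_differentiable[OF assms(2)] by (fastforce simp: dir_deriv_def)
  moreover have "smooth (\<lambda>p. \<Sum>b\<in>Basis. (X p \<bullet> b) *\<^sub>R frechet_derivative f (at p) b)"
    using assms by (intro smooth_sum smooth_scaleR smooth_inner_right smooth_frechet_derivative)
  ultimately show ?thesis by simp
qed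

lemma smooth_lie_bracket [intro]:
  fixes X :: "'a::euclidean_space \<Rightarrow> 'a"
  shows "smooth X \<Longrightarrow> smooth Y \<Longrightarrow> smooth (lie_bracket X Y)"
  unfolding lie_bracket_def[abs_def] by auto

text \<open>The real-valued case applies to each component \<open>f q \<bullet> b\<close>.\<close>

lemma symmetric_second_derivative:
  fixes f :: "'a::real_normed_vector \<Rightarrow> 'b::euclidean_space"
  assumes "smooth f"
  shows "frechet_derivative (\<lambda>q. frechet_derivative f (at q) u) (at p) v =
    frechet_derivative (\<lambda>q. frechet_derivative f (at q) v) (at p) u"
proof (rule euclidean_eqI)
  fix b :: 'b
  have inner: "frechet_derivative (\<lambda>q. F q \<bullet> b) (at p) w = frechet_derivative F (at p) w \<bullet> b"
    if "smooth F" for F :: "'a \<Rightarrow> 'b" and p w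
    by (rule frechet_derivative_at[THEN fun_cong, symmetric])
      (intro has_derivative_inner_left smooth_has_derivative that)
  have f: "smooth (\<lambda>q. f q \<bullet> b)"
    using assms by auto
  then show "frechet_derivative (\<lambda>q. frechet_derivative f (at q) u) (at p) v \<bullet> b =
    frechet_derivative (\<lambda>q. frechet_derivative f (at q) v) (at p) u \<bullet> b"
    using symmetric_second_derivative_real[of "\<lambda>q. f q \<bullet> b" u p v]
    by (simp add: inner[symmetric] assms smooth_frechet_derivative smooth_differentiable smooth_continuous)
qed

text \<open>Differentiating twice gives a Hessian term \<open>H (Y p) (X p)\<close> and the
  derivative of \<open>f\<close> in the direction of the derivative of \<open>Y\<close> along
  \<open>X\<close>. The Hessian terms cancel by symmetry, and the remaining directions combine to
  the Lie bracket.\<close>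

lemma dir_deriv_commutator:
  fixes X :: "'a::euclidean_space \<Rightarrow> 'a" and f :: "'a \<Rightarrow> 'b::euclidean_space"
  assumes "smooth X" "smooth Y" "smooth f"
  shows "dir_deriv X (dir_deriv Y f) p - dir_deriv Y (dir_deriv X f) p = dir_deriv (lie_bracket X Y) f p"
proof -
  define H where "H v w = frechet_derivative (\<lambda>q. frechet_derivative f (at q) v) (at p) w" for v w
  have lin: "linear (H v)" for v
    unfolding H_def using assms(3)
    by (intro linear_frechet_derivative smooth_differentiable smooth_frechet_derivative)
  have sym: "H v w = H w v" for v w
    unfolding H_def by (rule symmetric_second_derivative[OF assms(3)])
  \<comment> \<open>Linearity of \<open>H\<close> is known in the second argument; symmetry carries
    it over to the first.\<close>
  have expand: "(\<Sum>b\<in>Basis. (v \<bullet> b) *\<^sub>R H b w) = H v w" for v w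
    unfolding sym[of _ w]
    by (subst (2) euclidean_representation[of v, symmetric]) (simp only: linear_sum[OF lin] linear_cmul[OF lin])
  have second: "dir_deriv V (dir_deriv W f) p = H (W p) (V p) + frechet_derivative f (at p) (dir_deriv V W p)"
    if "smooth V" "smooth W" for V W
  proof -
    have eq: "dir_deriv W f = (\<lambda>q. \<Sum>b\<in>Basis. (W q \<bullet> b) *\<^sub>R frechet_derivative f (at q) b)"
      using frechet_derivative_Basis_sum smooth_differentiable[OF assms(3)] by (fastforce simp: dir_deriv_def)
    have "((\<lambda>q. \<Sum>b\<in>Basis. (W q \<bullet> b) *\<^sub>R frechet_derivative f (at q) b) has_derivative
       (\<lambda>v. \<Sum>b\<in>Basis. (W p \<bullet> b) *\<^sub>R H b v + (frechet_derivative W (at p) v \<bullet> b) *\<^sub>R frechet_derivative f (at p) b)) (at p)"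
      unfolding H_def
      by (intro has_derivative_sum has_derivative_scaleR has_derivative_inner_left
          smooth_has_derivative smooth_frechet_derivative that assms)
    from dir_deriv_eqI[OF this, of V] show ?thesis
      using frechet_derivative_Basis_sum[OF smooth_differentiable[OF assms(3)], of p "dir_deriv V W p"]
      by (simp add: eq sum.distrib expand dir_deriv_def)
  qed
  show ?thesis
    using linear_frechet_derivative[OF smooth_differentiable[OF assms(3)]] second assms sym
    by (simp add: dir_deriv_def[of "lie_bracket X Y"] lie_bracket_def linear_diff)
qed

section \<open>The Levi-Civita connection and the Ricci tensor\<close>

lemma has_derivative_component [derivative_intros]:
  "(f has_derivative f') F \<Longrightarrow> ((\<lambda>p. (f p :: real^'n) $ i) has_derivative (\<lambda>v. f' v $ i)) F"
  by (rule bounded_linear.has_derivative[OF bounded_linear_vec_nth])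

lemma has_derivative_vector_3 [derivative_intros]:
  assumes "(a has_derivative a') F" "(b has_derivative b') F" "(c has_derivative c') F"
  shows "((\<lambda>p. vector [a p, b p, c p] :: real^3) has_derivative (\<lambda>v. vector [a' v, b' v, c' v])) F"
  unfolding vector_3_axis
  by (intro has_derivative_add has_derivative_scaleR_left assms)

text \<open>The difference \<open>S\<close> of two such connections satisfies \<open>g(S(X,Y),Z) = g(S(Y,X),Z)\<close> and
  \<open>g(S(X,Y),Z) = - g(S(X,Z),Y)\<close>, hence vanishes.\<close>

lemma levi_civita_unique:
  fixes g :: "'a::real_normed_vector \<Rightarrow> 'a \<Rightarrow> 'a \<Rightarrow> real"
  assumes D: "torsion_free D" "metric_compatible g D"
    and D': "torsion_free D'" "metric_compatible g D'"
    and sym: "\<And>p u v. g p u v = g p v u"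
    and diff: "\<And>p u v w. g p (u - v) w = g p u w - g p v w"
    and nondeg: "\<And>p u. (\<And>v. g p u v = 0) \<Longrightarrow> u = 0"
    and XY: "smooth X" "smooth Y"
  shows "D X Y = D' X Y"
proof
  fix p
  define S where "S X Y Z = g p (D X Y p) (Z p) - g p (D' X Y p) (Z p)" for X Y Z
  have S_sym: "S X Y Z = S Y X Z" if "smooth X" "smooth Y" for X Y Z
  proof -
    have "D X Y p - D Y X p = D' X Y p - D' Y X p"
      using D(1) D'(1) that by (simp add: torsion_free_def)
    then have "g p (D X Y p - D Y X p) (Z p) = g p (D' X Y p - D' Y X p) (Z p)"
      by simp
    then show ?thesis
      by (simp add: S_def diff)
  qed
  have S_anti: "S X Y Z = - S X Z Y" if "smooth X" "smooth Y" "smooth Z" for X Y Z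
  proof -
    have "g p (D X Y p) (Z p) + g p (Y p) (D X Z p) = g p (D' X Y p) (Z p) + g p (Y p) (D' X Z p)"
      using D(2) D'(2) that unfolding metric_compatible_def by metis
    then show ?thesis
      by (simp add: S_def sym[of p "Y p"])
  qed
  have "g p (D X Y p - D' X Y p) v = 0" for v
  proof -
    define Z where "Z = (\<lambda>_::'a. v)"
    have Z: "smooth Z"
      by (simp add: Z_def)
    have "S X Y Z = - S X Z Y" "S X Z Y = S Z X Y" "S Z X Y = - S Z Y X" "S Z Y X = S Y Z X"
      "S Y Z X = - S Y X Z" "S Y X Z = S X Y Z"
      using XY Z S_sym S_anti by blast+
    then have "S X Y Z = 0"
      by linarith
    then show ?thesis
      by (simp add: S_def diff Z_def)
  qed
  then have "D X Y p - D' X Y p = 0"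
    by (rule nondeg)
  then show "D X Y p = D' X Y p"
    by simp
qed

section \<open>The Levi-Civita connection in global coordinates\<close>

text \<open>The Christoffel symbols of \<open>heis_g2 l\<close> in the coordinates x, y, z,
  contracted with two tangent vectors.\<close>

definition heis_christoffel :: "real \<Rightarrow> real^3 \<Rightarrow> real^3 \<Rightarrow> real^3 \<Rightarrow> real^3" where
  "heis_christoffel l p u v = (1 / 2) *\<^sub>R vector
    [l^2 * (u$2 * v$3 + u$3 * v$2 + 2 * p$1 * u$2 * v$2),
     - (u$1 * v$3 + u$3 * v$1) - p$1 * (u$1 * v$2 + u$2 * v$1),
     p$1 * (u$1 * v$3 + u$3 * v$1) + (1 + p$1 * p$1) * (u$1 * v$2 + u$2 * v$1)]"

text \<open>The derivative of \<open>heis_christoffel l p u v\<close> with respect to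
  \<open>p\<close> in direction \<open>w\<close>, for fixed \<open>u\<close> and
  \<open>v\<close>.\<close>

definition heis_christoffel_deriv :: "real \<Rightarrow> real^3 \<Rightarrow> real^3 \<Rightarrow> real^3 \<Rightarrow> real^3 \<Rightarrow> real^3" where
  "heis_christoffel_deriv l p w u v = (1 / 2) *\<^sub>R vector
    [2 * l^2 * w$1 * u$2 * v$2,
     - w$1 * (u$1 * v$2 + u$2 * v$1),
     w$1 * (u$1 * v$3 + u$3 * v$1) + 2 * p$1 * w$1 * (u$1 * v$2 + u$2 * v$1)]"

definition heis_connection :: "real \<Rightarrow> (real^3 \<Rightarrow> real^3) \<Rightarrow> (real^3 \<Rightarrow> real^3) \<Rightarrow> real^3 \<Rightarrow> real^3" where
  "heis_connection l X Y p = dir_deriv X Y p + heis_christoffel l p (X p) (Y p)"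

lemma heis_christoffel_simps [simp]:
  "heis_christoffel l p (u + u') v = heis_christoffel l p u v + heis_christoffel l p u' v"
  "heis_christoffel l p (u - u') v = heis_christoffel l p u v - heis_christoffel l p u' v"
  "heis_christoffel l p (a *\<^sub>R u) v = a *\<^sub>R heis_christoffel l p u v"
  "heis_christoffel l p u (v + v') = heis_christoffel l p u v + heis_christoffel l p u v'"
  "heis_christoffel l p u (v - v') = heis_christoffel l p u v - heis_christoffel l p u v'"
  "heis_christoffel l p u (a *\<^sub>R v) = a *\<^sub>R heis_christoffel l p u v"
  unfolding heis_christoffel_def vec_eq_iff forall_3
  by (simp; algebra)+

lemma heis_christoffel_commute: "heis_christoffel l p u v = heis_christoffel l p v u"
  by (simp add: heis_christoffel_def vec_eq_iff forall_3 algebra_simps)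

lemma smooth_heis_christoffel [intro]:
  assumes "smooth X" "smooth Y"
  shows "smooth (\<lambda>p. heis_christoffel l p (X p) (Y p))"
  unfolding heis_christoffel_def
  by (intro smooth_scaleR smooth_vector_3 smooth_add smooth_diff smooth_mult smooth_minus smooth_const
      smooth_component smooth_vec_nth assms)

text \<open>Product rule for a bilinear map that depends on the point: one term from its
  coefficients and one from each argument.\<close>

lemma dir_deriv_heis_christoffel:
  assumes "smooth Y" "smooth Z"
  shows "dir_deriv X (\<lambda>q. heis_christoffel l q (Y q) (Z q)) p =
    heis_christoffel_deriv l p (X p) (Y p) (Z p) + heis_christoffel l p (dir_deriv X Y p) (Z p)
    + heis_christoffel l p (Y p) (dir_deriv X Z p)"
proof -
  note deriv = assms[THEN smooth_has_derivative, of p]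
  let ?Y = "frechet_derivative Y (at p)" and ?Z = "frechet_derivative Z (at p)"
  have "((\<lambda>q. heis_christoffel l q (Y q) (Z q)) has_derivative (\<lambda>v.
      heis_christoffel_deriv l p v (Y p) (Z p) + heis_christoffel l p (?Y v) (Z p)
      + heis_christoffel l p (Y p) (?Z v))) (at p)"
    unfolding heis_christoffel_def
    by (rule has_derivative_eq_rhs, (rule derivative_intros deriv)+)
      (simp add: fun_eq_iff vec_eq_iff forall_3 heis_christoffel_deriv_def algebra_simps)
  from dir_deriv_eqI[OF this] show ?thesis
    by (simp add: dir_deriv_def)
qed

lemma smooth_heis_connection [intro]:
  "smooth X \<Longrightarrow> smooth Y \<Longrightarrow> smooth (heis_connection l X Y)"
  unfolding heis_connection_def[abs_def] by auto

lemma dir_deriv_add: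
  "smooth f \<Longrightarrow> smooth g \<Longrightarrow> dir_deriv X (\<lambda>q. f q + g q) p = dir_deriv X f p + dir_deriv X g p"
  unfolding dir_deriv_def
  by (rule frechet_derivative_at[THEN fun_cong, symmetric])
    (intro has_derivative_add smooth_has_derivative)

lemma dir_deriv_scaleR:
  "smooth f \<Longrightarrow> smooth g \<Longrightarrow>
    dir_deriv X (\<lambda>q. f q *\<^sub>R g q) p = dir_deriv X f p *\<^sub>R g p + f p *\<^sub>R dir_deriv X g p"
  unfolding dir_deriv_def
  by (rule frechet_derivative_at[THEN fun_cong, symmetric])
    (auto intro!: derivative_eq_intros smooth_has_derivative)

lemma affine_connection_heis: "affine_connection (heis_connection l)"
proof -
  have lin: "frechet_derivative Y (at p) (a *\<^sub>R u + b *\<^sub>R v) =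
      a *\<^sub>R frechet_derivative Y (at p) u + b *\<^sub>R frechet_derivative Y (at p) v"
    if "smooth Y" for Y :: "real^3 \<Rightarrow> real^3" and p u v a b
    using linear_frechet_derivative[OF smooth_differentiable[OF that]]
    by (simp add: linear_add linear_cmul)
  show ?thesis
    unfolding affine_connection_def
    \<comment> \<open>The two instances are additivity and, with second coefficient 0, homogeneity
      in the direction.\<close>
    using lin[of _ _ 1 _ 1] lin[of _ _ _ _ 0]
    by (auto simp: heis_connection_def dir_deriv_def dir_deriv_add[unfolded dir_deriv_def]
        dir_deriv_scaleR[unfolded dir_deriv_def] algebra_simps)
qed

lemma torsion_free_heis: "torsion_free (heis_connection l)"
  by (auto simp: torsion_free_def heis_connection_def lie_bracket_def intro: heis_christoffel_commute)

lemma metric_compatible_heis: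
  assumes "l \<noteq> 0"
  shows "metric_compatible (heis_g2 l) (heis_connection l)"
  unfolding metric_compatible_def
proof (intro allI impI)
  fix X Y Z :: "real^3 \<Rightarrow> real^3" and p
  assume "smooth X" "smooth Y" "smooth Z"
  note deriv = this(2,3)[THEN smooth_has_derivative, of p]
  let ?Y = "frechet_derivative Y (at p)" and ?Z = "frechet_derivative Z (at p)"
  \<comment> \<open>The last summand is the derivative of the metric coefficients, which depend on
    the point through \<open>p$1\<close> alone.\<close>
  have deriv_g: "((\<lambda>q. heis_g2 l q (Y q) (Z q)) has_derivative (\<lambda>v.
      heis_g2 l p (?Y v) (Z p) + heis_g2 l p (Y p) (?Z v)
      - v$1 * (Y p$2 * (p$1 * Z p$2 + Z p$3) + (p$1 * Y p$2 + Y p$3) * Z p$2))) (at p)"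
    unfolding heis_g2_def using assms
    by (auto intro!: derivative_eq_intros deriv simp: field_simps)
  show "dir_deriv X (\<lambda>q. heis_g2 l q (Y q) (Z q)) p =
    heis_g2 l p (heis_connection l X Y p) (Z p) + heis_g2 l p (Y p) (heis_connection l X Z p)"
    unfolding dir_deriv_eqI[OF deriv_g] using assms
    by (simp add: dir_deriv_def heis_connection_def heis_christoffel_def heis_g2_def
        field_simps power2_eq_square)
qed

text \<open>The explicit connection first serves as a witness that the choice made by
  \<open>SOME\<close> meets its conditions; uniqueness then identifies the two on smooth
  fields.\<close>

lemma levi_civita_heis:
  assumes "l \<noteq> 0" "smooth X" "smooth Y"
  shows "levi_civita (heis_g2 l) X Y = heis_connection l X Y"
proof (rule levi_civita_unique[where g = "heis_g2 l" and D = "levi_civita (heis_g2 l)"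
      and D' = "heis_connection l"])
  have "affine_connection (levi_civita (heis_g2 l)) \<and> torsion_free (levi_civita (heis_g2 l)) \<and>
      metric_compatible (heis_g2 l) (levi_civita (heis_g2 l))"
    unfolding levi_civita_def
    by (rule someI[of _ "heis_connection l"])
      (intro conjI affine_connection_heis torsion_free_heis metric_compatible_heis assms(1))
  then show "torsion_free (levi_civita (heis_g2 l))" "metric_compatible (heis_g2 l) (levi_civita (heis_g2 l))"
    by auto
  \<comment> \<open>Pairing with the three frame vectors recovers all components of
    \<open>u\<close>.\<close>
  show "u = 0" if "\<And>v. heis_g2 l p u v = 0" for p u
    using that[of "heis_frame l 1 p"] that[of "heis_frame l 2 p"] that[of "heis_frame l 3 p"] assms(1)
    by (auto simp: heis_g2_def heis_frame_def vec_eq_iff forall_3)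
qed (use assms torsion_free_heis metric_compatible_heis in
    \<open>auto simp: heis_g2_def algebra_simps diff_divide_distrib\<close>)

section \<open>Curvature and Ricci tensor\<close>

text \<open>All derivatives of the fields cancel: those of second order by the commutator formula,
  the mixed terms by symmetry in \<open>X\<close> and \<open>Y\<close>, and those with a derivative
  of \<open>X\<close> or \<open>Y\<close> against the bracket term. What remains is the classical
  expression by Christoffel symbols and their derivatives.\<close>

lemma curvature_heis:
  assumes "l \<noteq> 0" "smooth X" "smooth Y" "smooth Z"
  shows "curvature (levi_civita (heis_g2 l)) X Y Z p =
    heis_christoffel_deriv l p (X p) (Y p) (Z p) - heis_christoffel_deriv l p (Y p) (X p) (Z p)
    + heis_christoffel l p (X p) (heis_christoffel l p (Y p) (Z p))
    - heis_christoffel l p (Y p) (heis_christoffel l p (X p) (Z p))"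
proof -
  have second: "heis_connection l V (heis_connection l W Z) p =
      dir_deriv V (dir_deriv W Z) p + heis_christoffel_deriv l p (V p) (W p) (Z p)
      + heis_christoffel l p (dir_deriv V W p) (Z p) + heis_christoffel l p (W p) (dir_deriv V Z p)
      + heis_christoffel l p (V p) (dir_deriv W Z p)
      + heis_christoffel l p (V p) (heis_christoffel l p (W p) (Z p))"
    if "smooth V" "smooth W" for V W
  proof -
    have "heis_connection l W Z = (\<lambda>q. dir_deriv W Z q + heis_christoffel l q (W q) (Z q))"
      by (auto simp: heis_connection_def)
    then show ?thesis
      using that assms
      by (simp add: heis_connection_def[of l V] dir_deriv_add smooth_dir_deriv
          smooth_heis_christoffel dir_deriv_heis_christoffel)
  qed
  show ?thesis
    using dir_deriv_commutator[OF assms(2,3,4), of p] assms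
    by (simp add: curvature_def levi_civita_heis smooth_heis_connection smooth_lie_bracket second
        heis_connection_def[of l "lie_bracket X Y"] lie_bracket_def[of X Y p] algebra_simps)
qed

text \<open>This is \<open>l^2 / 2\<close> times the Riemannian metric obtained from
  \<open>heis_g2 l\<close> by reversing the sign of its timelike square.\<close>

definition heis_ricci :: "real \<Rightarrow> real^3 \<Rightarrow> real^3 \<Rightarrow> real^3 \<Rightarrow> real" where
  "heis_ricci l p u v =
    (u$1 * v$1 + l^2 * (u$2 * v$2 + (p$1 * u$2 + u$3) * (p$1 * v$2 + v$3))) / 2"

lemma heis_frame_fields:
  "heis_frame l 1 = (\<lambda>p. vector [0, 1, - p$1])" "heis_frame l 2 = (\<lambda>p. vector [l, 0, 0])"
  "heis_frame l 3 = (\<lambda>p. vector [0, 0, 1])"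
  by (auto simp: heis_frame_def)

lemma smooth_heis_frame [intro, simp]: "smooth (heis_frame l k)"
  using exhaust_3[of k] by (auto simp: heis_frame_fields intro!: smooth_vector_3 smooth_minus)

lemma ricci_heis:
  assumes "l \<noteq> 0" "smooth Y" "smooth Z"
  shows "ricci (heis_g2 l) (heis_frame l) Y Z = (\<lambda>p. heis_ricci l p (Y p) (Z p))"
proof
  fix p
  show "ricci (heis_g2 l) (heis_frame l) Y Z p = heis_ricci l p (Y p) (Z p)"
    unfolding ricci_def sum_3
    using assms
    by (simp add: curvature_heis heis_frame_orthonormal)
      (simp add: heis_g2_def heis_frame_def heis_christoffel_def heis_christoffel_deriv_def
        heis_ricci_def field_simps power2_eq_square)
qed

section \<open>Ricci collineations\<close>

lemma dir_deriv_heis_ricci: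
  assumes "smooth Y" "smooth Z"
  shows "dir_deriv X (\<lambda>q. heis_ricci l q (Y q) (Z q)) p =
    l^2 * X p$1 * (Y p$2 * (p$1 * Z p$2 + Z p$3) + (p$1 * Y p$2 + Y p$3) * Z p$2) / 2
    + heis_ricci l p (dir_deriv X Y p) (Z p) + heis_ricci l p (Y p) (dir_deriv X Z p)"
proof -
  note deriv = assms[THEN smooth_has_derivative, of p]
  let ?Y = "frechet_derivative Y (at p)" and ?Z = "frechet_derivative Z (at p)"
  have "((\<lambda>q. heis_ricci l q (Y q) (Z q)) has_derivative (\<lambda>v.
      l^2 * v$1 * (Y p$2 * (p$1 * Z p$2 + Z p$3) + (p$1 * Y p$2 + Y p$3) * Z p$2) / 2
      + heis_ricci l p (?Y v) (Z p) + heis_ricci l p (Y p) (?Z v))) (at p)"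
    unfolding heis_ricci_def
    by (auto intro!: derivative_eq_intros deriv simp: field_simps)
  from dir_deriv_eqI[OF this] show ?thesis
    by (simp add: dir_deriv_def)
qed

text \<open>The derivatives of \<open>Y\<close> and \<open>Z\<close> cancel against those in the
  brackets, so the Lie derivative depends on their values at the point only. Constant fields
  therefore suffice to test it.\<close>

lemma ricci_collineation_heis:
  assumes "l \<noteq> 0" "smooth X"
  shows "ricci_collineation (heis_g2 l) (heis_frame l) X \<longleftrightarrow>
    (\<forall>p u v. l^2 * X p$1 * (u$2 * (p$1 * v$2 + v$3) + (p$1 * u$2 + u$3) * v$2) / 2
      + heis_ricci l p (frechet_derivative X (at p) u) v
      + heis_ricci l p u (frechet_derivative X (at p) v) = 0)"
    (is "_ \<longleftrightarrow> (\<forall>p u v. ?L p u v = 0)")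
proof -
  have "lie_deriv2 X (ricci (heis_g2 l) (heis_frame l)) Y Z p = ?L p (Y p) (Z p)"
    if "smooth Y" "smooth Z" for Y Z p
    using assms that
    by (simp add: lie_deriv2_def ricci_heis smooth_lie_bracket dir_deriv_heis_ricci)
      (simp add: heis_ricci_def lie_bracket_def dir_deriv_def field_simps)
  then show ?thesis
    using assms(2) smooth_const unfolding ricci_collineation_def by metis
qed

section \<open>The Killing equations in the left-invariant frame\<close>

abbreviation (input) heis_field :: "real \<Rightarrow> (real^3 \<Rightarrow> real) \<Rightarrow> (real^3 \<Rightarrow> real) \<Rightarrow> (real^3 \<Rightarrow> real) \<Rightarrow> real^3 \<Rightarrow> real^3" where
  "heis_field l f1 f2 f3 \<equiv>
    \<lambda>p. f1 p *\<^sub>R heis_frame l 1 p + f2 p *\<^sub>R heis_frame l 2 p + f3 p *\<^sub>R heis_frame l 3 p"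

text \<open>The coefficients are the values on \<open>u\<close> of the dual coframe dy, dx /
  \<open>l\<close>, x dy + dz.\<close>

lemma heis_frame_expansion:
  assumes "l \<noteq> 0"
  shows "u = u$2 *\<^sub>R heis_frame l 1 p + (u$1 / l) *\<^sub>R heis_frame l 2 p
    + (p$1 * u$2 + u$3) *\<^sub>R heis_frame l 3 p"
  using assms by (simp add: heis_frame_def vec_eq_iff forall_3)

lemma frechet_derivative_heis_frame:
  assumes "l \<noteq> 0" "smooth (f :: real^3 \<Rightarrow> real)"
  shows "frechet_derivative f (at p) u = u$2 * dir_deriv (heis_frame l 1) f p
    + u$1 / l * dir_deriv (heis_frame l 2) f p
    + (p$1 * u$2 + u$3) * dir_deriv (heis_frame l 3) f p"
  using linear_frechet_derivative[OF smooth_differentiable[OF assms(2)], of p]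
  by (subst heis_frame_expansion[OF assms(1), of u p])
    (simp only: linear_add linear_cmul dir_deriv_def real_scaleR_def)

text \<open>The Lie derivative is a symmetric bilinear form at each point, and its values on the six
  pairs of frame vectors are the six equations. Conversely, writing all derivatives through the
  frame makes the form vanish on arbitrary vectors.\<close>

lemma ricci_collineation_heis_field:
  assumes "l \<noteq> 0" and f: "smooth f1" "smooth f2" "smooth f3"
  shows "ricci_collineation (heis_g2 l) (heis_frame l) (heis_field l f1 f2 f3) \<longleftrightarrow>
    (\<forall>p. dir_deriv (heis_frame l 1) f1 p = 0 \<and> dir_deriv (heis_frame l 2) f2 p = 0 \<and>
      dir_deriv (heis_frame l 3) f3 p = 0 \<and>
      dir_deriv (heis_frame l 2) f1 p = - dir_deriv (heis_frame l 1) f2 p \<and>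
      dir_deriv (heis_frame l 1) f3 p = - l * f2 p - dir_deriv (heis_frame l 3) f1 p \<and>
      dir_deriv (heis_frame l 2) f3 p = l * f1 p - dir_deriv (heis_frame l 3) f2 p)"
    (is "_ \<longleftrightarrow> (\<forall>p. ?E p)")
proof -
  let ?X = "heis_field l f1 f2 f3"
  let ?d1 = "\<lambda>p. frechet_derivative f1 (at p)" and ?d2 = "\<lambda>p. frechet_derivative f2 (at p)"
    and ?d3 = "\<lambda>p. frechet_derivative f3 (at p)"
  have X: "?X p = vector [l * f2 p, f1 p, f3 p - p$1 * f1 p]" for p
    by (simp add: heis_frame_def vec_eq_iff forall_3)
  have smooth_X: "smooth ?X"
    by (intro smooth_add smooth_scaleR smooth_heis_frame f)
  have dX: "frechet_derivative ?X (at p) = (\<lambda>u. vector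
      [l * ?d2 p u, ?d1 p u, ?d3 p u - p$1 * ?d1 p u - u$1 * f1 p])" for p
    unfolding X
    by (rule frechet_derivative_at[symmetric])
      (auto intro!: derivative_eq_intros smooth_has_derivative f simp: fun_eq_iff algebra_simps)
  \<comment> \<open>The Lie derivative with the nonzero factor \<open>l^2 / 2\<close> divided
    out.\<close>
  let ?L = "\<lambda>p u v. l * f2 p * (u$2 * (p$1 * v$2 + v$3) + (p$1 * u$2 + u$3) * v$2)
      + (?d2 p u * v$1 + u$1 * ?d2 p v) / l + ?d1 p u * v$2 + u$2 * ?d1 p v
      + (?d3 p u - u$1 * f1 p) * (p$1 * v$2 + v$3) + (p$1 * u$2 + u$3) * (?d3 p v - v$1 * f1 p)"
  have L: "l^2 * ?X p$1 * (u$2 * (p$1 * v$2 + v$3) + (p$1 * u$2 + u$3) * v$2) / 2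
      + heis_ricci l p (frechet_derivative ?X (at p) u) v
      + heis_ricci l p u (frechet_derivative ?X (at p) v) = l^2 / 2 * ?L p u v" for p u v
    unfolding dX unfolding X heis_ricci_def
    using assms(1) by (simp add: field_simps power2_eq_square)
  have "ricci_collineation (heis_g2 l) (heis_frame l) ?X \<longleftrightarrow> (\<forall>p u v. l^2 / 2 * ?L p u v = 0)"
    unfolding ricci_collineation_heis[OF assms(1) smooth_X] L ..
  also have "\<dots> \<longleftrightarrow> (\<forall>p u v. ?L p u v = 0)"
    using assms(1) by simp
  finally have collineation_iff:
    "ricci_collineation (heis_g2 l) (heis_frame l) ?X \<longleftrightarrow> (\<forall>p u v. ?L p u v = 0)" .
  have "(\<forall>u v. ?L p u v = 0) \<longleftrightarrow> ?E p" for p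
  proof
    assume "\<forall>u v. ?L p u v = 0"
    then have "?L p (heis_frame l i p) (heis_frame l j p) = 0" for i j
      by blast
    from this[of 1 1] this[of 2 2] this[of 3 3] this[of 1 2] this[of 1 3] this[of 2 3]
    show "?E p"
      using assms(1) by (simp add: dir_deriv_def[symmetric]) (simp add: heis_frame_def field_simps)
  next
    assume "?E p"
    then show "\<forall>u v. ?L p u v = 0"
      using assms(1) by (simp add: frechet_derivative_heis_frame[OF assms(1)] f) (simp add: field_simps)
  qed
  then show ?thesis
    unfolding collineation_iff by (rule arg_cong[where f = All, OF ext])
qed

text \<open>The Lie brackets of the Heisenberg algebra, where the first two frame fields have
  bracket \<open>l\<close> times the third and the third is central, turned into relations between
  derivations.\<close>

lemma heis_frame_commutator:
  assumes "smooth (f :: real^3 \<Rightarrow> real)"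
  shows "dir_deriv (heis_frame l 1) (dir_deriv (heis_frame l 2) f) p
      - dir_deriv (heis_frame l 2) (dir_deriv (heis_frame l 1) f) p = l * dir_deriv (heis_frame l 3) f p"
    and "dir_deriv (heis_frame l i) (dir_deriv (heis_frame l 3) f) p =
      dir_deriv (heis_frame l 3) (dir_deriv (heis_frame l i) f) p"
proof -
  \<comment> \<open>Among the frame fields only the first has non-constant coefficients.\<close>
  have d1: "frechet_derivative (heis_frame l 1) (at p) u = vector [0, 0, - u$1]"
    and d2: "frechet_derivative (heis_frame l 2) (at p) u = 0"
    and d3: "frechet_derivative (heis_frame l 3) (at p) u = 0" for u
  proof -
    have "((\<lambda>p. vector [0, 1, - p$1] :: real^3) has_derivative (\<lambda>u. vector [0, 0, - u$1])) (at p)"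
      by (auto intro!: derivative_eq_intros)
    then show "frechet_derivative (heis_frame l 1) (at p) u = vector [0, 0, - u$1]"
      "frechet_derivative (heis_frame l 2) (at p) u = 0"
      "frechet_derivative (heis_frame l 3) (at p) u = 0"
      by (auto simp: heis_frame_fields frechet_derivative_at[symmetric])
  qed
  note lin = linear_frechet_derivative[OF smooth_differentiable[OF assms], of p]
  have "lie_bracket (heis_frame l 1) (heis_frame l 2) p = l *\<^sub>R heis_frame l 3 p"
    by (simp add: lie_bracket_def dir_deriv_def d1 d2 heis_frame_def vec_eq_iff forall_3)
  then show "dir_deriv (heis_frame l 1) (dir_deriv (heis_frame l 2) f) p
      - dir_deriv (heis_frame l 2) (dir_deriv (heis_frame l 1) f) p = l * dir_deriv (heis_frame l 3) f p"
    using linear_cmul[OF lin] assms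
    by (simp add: dir_deriv_commutator) (simp add: dir_deriv_def)
  have "lie_bracket (heis_frame l i) (heis_frame l 3) p = 0"
    using exhaust_3[of i]
    by (auto simp: lie_bracket_def dir_deriv_def d1 d2 d3 heis_frame_def vec_eq_iff forall_3)
  with linear_0[OF lin] dir_deriv_commutator[OF smooth_heis_frame[of l i] smooth_heis_frame[of l 3] assms, of p]
  show "dir_deriv (heis_frame l i) (dir_deriv (heis_frame l 3) f) p =
      dir_deriv (heis_frame l 3) (dir_deriv (heis_frame l i) f) p"
    by (simp add: dir_deriv_def[of "lie_bracket _ _"])
qed

section \<open>Integration of the frame equations\<close>

lemma eq_add_const_if_derivative_eq:
  fixes f g :: "'a::real_normed_vector \<Rightarrow> 'b::real_normed_vector"
  assumes "\<And>p. (f has_derivative f' p) (at p)" "\<And>p. (g has_derivative f' p) (at p)"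
  obtains c where "\<And>p. f p = g p + c"
proof -
  have "((\<lambda>p. f p - g p) has_derivative (\<lambda>_. 0)) (at p)" for p
    using has_derivative_diff[OF assms] by simp
  then obtain c where "\<And>p. f p - g p = c"
    using has_derivative_zero_constant[of UNIV "\<lambda>p. f p - g p"] by auto
  then show thesis
    by (intro that[of c]) (simp add: algebra_simps)
qed

lemma dir_deriv_const [simp]: "dir_deriv X (\<lambda>_. c) p = 0"
  by (simp add: dir_deriv_def)

lemma dir_deriv_minus: "smooth f \<Longrightarrow> dir_deriv X (\<lambda>q. - f q) p = - dir_deriv X f p"
  by (subst dir_deriv_eqI[OF has_derivative_minus[OF smooth_has_derivative]]) (simp_all add: dir_deriv_def)

lemma dir_deriv_diff:
  "smooth f \<Longrightarrow> smooth g \<Longrightarrow> dir_deriv X (\<lambda>q. f q - g q) p = dir_deriv X f p - dir_deriv X g p"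
  using dir_deriv_add[OF _ smooth_minus] dir_deriv_minus by fastforce

lemma dir_deriv_mult_left:
  fixes f :: "'a::real_normed_vector \<Rightarrow> real"
  shows "smooth f \<Longrightarrow> dir_deriv X (\<lambda>q. a * f q) p = a * dir_deriv X f p"
  using dir_deriv_scaleR[OF smooth_const, of f X a p] by simp

lemma frame_equations_solution:
  fixes l :: real and f1 f2 f3 :: "real^3 \<Rightarrow> real"
  defines "e \<equiv> \<lambda>i (f :: real^3 \<Rightarrow> real). dir_deriv (heis_frame l i) f"
  assumes l: "l \<noteq> 0" and f: "smooth f1" "smooth f2" "smooth f3"
    and eqs: "\<And>p. e 1 f1 p = 0" "\<And>p. e 2 f2 p = 0" "\<And>p. e 3 f3 p = 0"
      "\<And>p. e 2 f1 p = - e 1 f2 p" "\<And>p. e 1 f3 p = - l * f2 p - e 3 f1 p"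
      "\<And>p. e 2 f3 p = l * f1 p - e 3 f2 p"
  obtains c1 c2 c3 c4 where "\<And>p. f1 p = - (c1 / l) * p$1 + c2" "\<And>p. f2 p = c1 * p$2 + c3"
    "\<And>p. f3 p = - (c1 / (2 * l)) * (p$1)^2 - (l * c1 / 2) * (p$2)^2 + c2 * p$1 - l * c3 * p$2 + c4"
proof -
  have smooth_e: "smooth (e i g)" if "smooth g" for i g
    unfolding e_def using that by auto
  have e_minus: "e i (\<lambda>q. - g q) p = - e i g p"
    and e_diff: "smooth h \<Longrightarrow> e i (\<lambda>q. g q - h q) p = e i g p - e i h p"
    and e_mult: "e i (\<lambda>q. a * g q) p = a * e i g p"
    if "smooth g" for i a g h p
    unfolding e_def using that by (simp_all add: dir_deriv_minus dir_deriv_diff dir_deriv_mult_left)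
  have e_const: "e i (\<lambda>_. a) p = 0" for i a p
    by (simp add: e_def)
  have e12: "e 1 (e 2 g) p - e 2 (e 1 g) p = l * e 3 g p"
    and e_3: "e i (e 3 g) p = e 3 (e i g) p" if "smooth g" for i g p
    unfolding e_def using that by (rule heis_frame_commutator)+
  note smooth = f smooth_e smooth_minus smooth_mult

  have feqs: "e 1 f1 = (\<lambda>_. 0)" "e 2 f2 = (\<lambda>_. 0)" "e 3 f3 = (\<lambda>_. 0)"
    "e 2 f1 = (\<lambda>p. - e 1 f2 p)" "e 1 f3 = (\<lambda>p. - (l * f2 p) - e 3 f1 p)"
    "e 2 f3 = (\<lambda>p. l * f1 p - e 3 f2 p)"
    using eqs by (auto simp: fun_eq_iff)

  \<comment> \<open>As \<open>e 3 f3\<close> vanishes and \<open>e 3\<close> commutes with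
    \<open>e 1\<close> and \<open>e 2\<close>, applying \<open>e 3\<close> to the equations for
    \<open>e 1 f3\<close> and \<open>e 2 f3\<close> gives zero.\<close>
  have e33_f1: "e 3 (e 3 f1) p = - l * e 3 f2 p" and e33_f2: "e 3 (e 3 f2) p = l * e 3 f1 p" for p
    using e_3[OF f(3), of 1 p] e_3[OF f(3), of 2 p]
    unfolding feqs by (simp_all add: e_minus e_diff e_mult e_const smooth)
  have e3_e2_f1: "e 3 (e 2 f1) p = - e 3 (e 1 f2) p" for p
    unfolding feqs(4) by (simp add: e_minus e_diff e_mult smooth)
  \<comment> \<open>The commutator relation for \<open>f3\<close> yields the sum below; by
    \<open>e3_e2_f1\<close> its two terms are equal, so each is zero.\<close>
  have e3_e1_f2: "e 3 (e 1 f2) p = 0" for p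
  proof -
    have "- e 1 (e 3 f2) p + e 2 (e 3 f1) p = 0"
      using e12[OF f(3), of p] unfolding feqs(5,6) by (simp add: e_minus e_diff e_mult smooth eqs(1-3))
    then show ?thesis
      by (simp add: e_3 f e3_e2_f1)
  qed
  \<comment> \<open>Here \<open>e 3 g\<close> is annihilated by \<open>e 1\<close> and
    \<open>e 2\<close>, hence by their commutator, which is \<open>l\<close> times
    \<open>e 3\<close>.\<close>
  have e33_vanish: "e 3 (e 3 g) p = 0" if "smooth g" "\<And>q. e 3 (e 1 g) q = 0" "\<And>q. e 3 (e 2 g) q = 0" for g p
  proof -
    have "e 1 (e 3 g) = (\<lambda>_. 0)" "e 2 (e 3 g) = (\<lambda>_. 0)"
      using that by (auto simp: e_3)
    with e12[OF smooth_e[OF that(1)], of 3 p] l show ?thesis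
      by (simp add: e_const)
  qed
  \<comment> \<open>The second derivatives along \<open>e 3\<close> vanish, and by
    \<open>e33_f1\<close> and \<open>e33_f2\<close> they are nonzero multiples of
    \<open>e 3 f2\<close> and \<open>e 3 f1\<close>.\<close>
  have e3: "e 3 f1 p = 0" "e 3 f2 p = 0" for p
    using e33_vanish[of f1 p] e33_vanish[of f2 p] e33_f1[of p] e33_f2[of p] l
    by (simp_all add: f e3_e2_f1 e3_e1_f2 feqs(1,2) e_const)

  have de: "frechet_derivative g (at p) = (\<lambda>u. u$2 * e 1 g p + u$1 / l * e 2 g p + (p$1 * u$2 + u$3) * e 3 g p)"
    if "smooth g" for g p
    unfolding e_def using frechet_derivative_heis_frame[OF l that] by blast
  \<comment> \<open>The commutator relations for \<open>f1\<close> and \<open>f2\<close>, whose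
    right sides are now zero, give the two remaining derivatives of \<open>e 1 f2\<close>.\<close>
  have e1_e1_f2: "e 1 (e 1 f2) p = 0" for p
    using e12[OF f(1), of p] unfolding feqs(1,4) by (simp add: e_minus e_diff e_mult smooth e_const e3)
  have e2_e1_f2: "e 2 (e 1 f2) p = 0" for p
    using e12[OF f(2), of p] unfolding feqs(2) by (simp add: e_const e3)
  have "(e 1 f2 has_derivative (\<lambda>_. 0)) (at p)" for p
    using smooth_has_derivative[OF smooth_e[OF f(2)], of 1 p]
    by (simp add: de smooth e3_e1_f2 e1_e1_f2 e2_e1_f2)
  then obtain c1 where c1: "\<And>p. e 1 f2 p = c1"
    using eq_add_const_if_derivative_eq[of "e 1 f2" "\<lambda>_ _. 0" "\<lambda>_. 0"] by auto
  \<comment> \<open>All frame derivatives of \<open>f1\<close> and \<open>f2\<close> are known: the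
    differentials are - (\<open>c1 / l\<close>) dx and \<open>c1\<close> dy.\<close>
  have "(f1 has_derivative (\<lambda>u. - (c1 / l) * u$1)) (at p)" for p
    using smooth_has_derivative[OF f(1), of p] by (simp add: de f eqs e3 c1 mult.commute)
  then obtain c2 where c2: "\<And>p. f1 p = - (c1 / l) * p$1 + c2"
    by (rule eq_add_const_if_derivative_eq[where g = "\<lambda>p. - (c1 / l) * p$1"])
      (use l in \<open>auto intro!: derivative_eq_intros\<close>)
  have "(f2 has_derivative (\<lambda>u. c1 * u$2)) (at p)" for p
    using smooth_has_derivative[OF f(2), of p] by (simp add: de f eqs e3 c1 mult.commute)
  then obtain c3 where c3: "\<And>p. f2 p = c1 * p$2 + c3"
    by (rule eq_add_const_if_derivative_eq[where g = "\<lambda>p. c1 * p$2"])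
      (auto intro!: derivative_eq_intros)
  \<comment> \<open>A primitive of \<open>f1\<close> dx - \<open>l * f2\<close> dy, found by
    inserting the solutions for \<open>f1\<close> and \<open>f2\<close>.\<close>
  define g3 where "g3 p = - (c1 / (2 * l)) * (p$1)^2 - (l * c1 / 2) * (p$2)^2 + c2 * p$1 - l * c3 * p$2"
    for p :: "real^3"
  have "(f3 has_derivative (\<lambda>u. f1 p * u$1 - l * f2 p * u$2)) (at p)" for p
    using smooth_has_derivative[OF f(3), of p] l by (simp add: de f eqs e3 mult_ac)
  moreover have "(g3 has_derivative (\<lambda>u. f1 p * u$1 - l * f2 p * u$2)) (at p)" for p
    unfolding g3_def c2 c3 using l
    by (auto intro!: derivative_eq_intros simp: fun_eq_iff field_simps)
  ultimately obtain c4 where "\<And>p. f3 p = g3 p + c4"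
    by (rule eq_add_const_if_derivative_eq) blast
  with c2 c3 show thesis
    by (intro that) (auto simp: g3_def)
qed

theorem theorem4p3:
  fixes l :: real and f1 f2 f3 :: "real^3 \<Rightarrow> real"
  assumes "l \<noteq> 0" and "smooth f1" and "smooth f2" and "smooth f3"
  shows "ricci_collineation (heis_g2 l) (heis_frame l)
      (\<lambda>p. f1 p *\<^sub>R heis_frame l 1 p + f2 p *\<^sub>R heis_frame l 2 p + f3 p *\<^sub>R heis_frame l 3 p)
    \<longleftrightarrow>
    (\<exists>c1 c2 c3 c4. \<forall>x y z.
       f1 (vector [x, y, z]) = - (c1 / l) * x + c2 \<and>
       f2 (vector [x, y, z]) = c1 * y + c3 \<and>
       f3 (vector [x, y, z]) =
         - (c1 / (2 * l)) * x^2 - (l * c1 / 2) * y^2 + c2 * x - l * c3 * y + c4)"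
    (is "?collineation \<longleftrightarrow> ?solution")
proof
  assume ?collineation
  then have eqs: "dir_deriv (heis_frame l 1) f1 p = 0" "dir_deriv (heis_frame l 2) f2 p = 0"
    "dir_deriv (heis_frame l 3) f3 p = 0"
    "dir_deriv (heis_frame l 2) f1 p = - dir_deriv (heis_frame l 1) f2 p"
    "dir_deriv (heis_frame l 1) f3 p = - l * f2 p - dir_deriv (heis_frame l 3) f1 p"
    "dir_deriv (heis_frame l 2) f3 p = l * f1 p - dir_deriv (heis_frame l 3) f2 p" for p
    unfolding ricci_collineation_heis_field[OF assms] by blast+
  obtain c1 c2 c3 c4 where "\<And>p. f1 p = - (c1 / l) * p$1 + c2" "\<And>p. f2 p = c1 * p$2 + c3"
    "\<And>p. f3 p = - (c1 / (2 * l)) * (p$1)^2 - (l * c1 / 2) * (p$2)^2 + c2 * p$1 - l * c3 * p$2 + c4"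
    using frame_equations_solution[OF assms eqs] by blast
  then show ?solution
    by (intro exI[of _ c1] exI[of _ c2] exI[of _ c3] exI[of _ c4]) simp
next
  assume ?solution
  then obtain c1 c2 c3 c4 where sol: "\<And>x y z.
       f1 (vector [x, y, z]) = - (c1 / l) * x + c2 \<and>
       f2 (vector [x, y, z]) = c1 * y + c3 \<and>
       f3 (vector [x, y, z]) =
         - (c1 / (2 * l)) * x^2 - (l * c1 / 2) * y^2 + c2 * x - l * c3 * y + c4"
    by blast
  have vector: "vector [p$1, p$2, p$3] = p" for p :: "real^3"
    by (simp add: vec_eq_iff forall_3)
  have f1: "f1 = (\<lambda>p. - (c1 / l) * p$1 + c2)" and f2: "f2 = (\<lambda>p. c1 * p$2 + c3)"
    and f3: "f3 = (\<lambda>p. - (c1 / (2 * l)) * (p$1)^2 - (l * c1 / 2) * (p$2)^2 + c2 * p$1 - l * c3 * p$2 + c4)"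
    using sol[of "p$1" "p$2" "p$3" for p :: "real^3", unfolded vector] by blast+
  \<comment> \<open>With the differential of \<open>f3\<close> kept in terms of \<open>f1\<close>
    and \<open>f2\<close>, evaluation on the frame vectors gives the six equations directly.\<close>
  have "(f1 has_derivative (\<lambda>u. - (c1 / l) * u$1)) (at p)"
    and "(f2 has_derivative (\<lambda>u. c1 * u$2)) (at p)"
    and "(f3 has_derivative (\<lambda>u. f1 p * u$1 - l * f2 p * u$2)) (at p)" for p
    unfolding f1 f2 f3 using assms(1)
    by (auto intro!: derivative_eq_intros simp: fun_eq_iff field_simps)
  note deriv = this[THEN dir_deriv_eqI]
  show ?collineation
    unfolding ricci_collineation_heis_field[OF assms]
    using assms(1) by (simp add: deriv) (simp add: heis_frame_def)
qed

end
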